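(* Let $\lambda$ be a nonzero real number and let $(b_n(\lambda))_{n\ge0}$ be any sequence of real numbers. Define the degenerate A-algorithm matrix $(b_{n,m}(\lambda))_{n,m\ge0}$ by $b_{0,m}(\lambda)=b_m(\lambda)$ for $m\ge0$ and \[ b_{n,m}(\lambda)=(m+1)\Big(\Big(1-\frac{(n-1)\lambda}{m+1}\Big)b_{n-1,m}(\lambda)-b_{n-1,m+1}(\lambda)\Big),\qquad n\ge1,\ m\ge0. \] Let $G_\lambda(t)=\sum_{n\ge0}b_{0,n}(\lambda)t^n$ and $\overline{G}_\lambda(t)=\sum_{n\ge0}b_{n,0}(\lambda)\frac{t^n}{n!}$ (formal power series). Then, as formal power series, \[ \overline{G}_{\lambda}(t)=e_{\lambda}(t)\,G_{\lambda}\big(1-e_{\lambda}(t)\big)\qquad\text{and}\qquad (1-t)G_{\lambda}(t)=\overline{G}_{\lambda}\big(\log_{\lambda}(1-t)\big). \]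
   Context: For $n\ge0$ set $(x)_{0,\lambda}=1$ and $(x)_{n,\lambda}=x(x-\lambda)\cdots(x-(n-1)\lambda)$ for $n\ge1$. The degenerate exponential is $e_\lambda(t)=\sum_{k\ge0}(1)_{k,\lambda}\frac{t^k}{k!}$ (i.e. $(1+\lambda t)^{1/\lambda}$), a power series with constant term $1$, and $\log_\lambda$ denotes its compositional inverse, so that $\log_\lambda(1+t)=\sum_{n\ge1}\frac{(-1)^{n-1}}{n}\binom{n-1-\lambda}{n-1}t^n$. Compositions are compositions of formal power series (inner series have zero constant term). *)

theory Defs
  imports "HOL-Computational_Algebra.Formal_Power_Series"
begin

definition dfall :: "real \<Rightarrow> real \<Rightarrow> nat \<Rightarrow> real" where
  "dfall lam x n = (\<Prod>i<n. x - real i * lam)"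

definition dexp :: "real \<Rightarrow> real fps" where
  "dexp lam = Abs_fps (\<lambda>k. dfall lam 1 k / fact k)"

text \<open>The series \<open>dlog1p lam\<close> in \<open>t\<close> stands for \<open>log\<^sub>\<lambda>(1 + t)\<close>. Since \<open>dexp lam\<close> has constant
  term 1, the compositional inverse is centred at 1: it is the inverse of \<open>dexp lam - 1\<close>.
  Accordingly \<open>log\<^sub>\<lambda>(1 - t)\<close> is \<open>dlog1p lam oo (- fps_X)\<close>.\<close>
definition dlog1p :: "real \<Rightarrow> real fps" where
  "dlog1p lam = fps_inv (dexp lam - 1)"

text \<open>The recurrence below is indexed by the successor of \<open>n\<close>, so the factor \<open>n - 1\<close>
  of the row-\<open>n\<close> formula appears as \<open>n\<close> in row \<open>Suc n\<close>.\<close>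
primrec dA :: "real \<Rightarrow> (nat \<Rightarrow> real) \<Rightarrow> nat \<Rightarrow> nat \<Rightarrow> real" where
  "dA lam b 0 = b"
| "dA lam b (Suc n) = (\<lambda>m. real (m + 1) *
     ((1 - real n * lam / real (m + 1)) * dA lam b n m - dA lam b n (m + 1)))"

definition dA_gf :: "real \<Rightarrow> (nat \<Rightarrow> real) \<Rightarrow> real fps" where
  "dA_gf lam b = Abs_fps (\<lambda>n. dA lam b 0 n)"

definition dA_egf :: "real \<Rightarrow> (nat \<Rightarrow> real) \<Rightarrow> real fps" where
  "dA_egf lam b = Abs_fps (\<lambda>n. dA lam b n 0 / fact n)"

lemma dfall_simps [simp]:
  "dfall lam x 0 = 1"
  "dfall lam x (Suc n) = dfall lam x n * (x - real n * lam)"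
  by (simp_all add: dfall_def)

lemma dexp_nth [simp]: "fps_nth (dexp lam) n = dfall lam 1 n / fact n"
  by (simp add: dexp_def)

lemma dexp_Suc:
  "real (Suc n) * fps_nth (dexp lam) (Suc n) = (1 - real n * lam) * fps_nth (dexp lam) n"
  by (simp add: divide_simps)

lemma dlog1p_left: "dlog1p lam oo (dexp lam - 1) = fps_X"
  unfolding dlog1p_def by (rule fps_inv) simp_all

lemma dlog1p_right: "(dexp lam - 1) oo dlog1p lam = fps_X"
  unfolding dlog1p_def by (rule fps_inv_right) simp_all

lemma dlog1p_nth_0 [simp]: "fps_nth (dlog1p lam) 0 = 0"
  by (simp add: dlog1p_def fps_inv_def)

lemma dlog1p_unique:
  assumes "L oo (dexp lam - 1) = fps_X"
  shows "L = dlog1p lam"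
proof -
  have "L = L oo ((dexp lam - 1) oo dlog1p lam)"
    by (simp add: dlog1p_right)
  also have "\<dots> = (L oo (dexp lam - 1)) oo dlog1p lam"
    by (rule fps_compose_assoc) simp_all
  finally show ?thesis
    using assms by simp
qed

lemma dlog1p_series:
  "dlog1p lam =
     Abs_fps (\<lambda>n. if n = 0 then 0 else (-1) ^ (n - 1) / real n * ((real (n - 1) - lam) gchoose (n - 1)))"
    (is "_ = ?L")
proof -
  define L where "L = ?L"
  have L_Suc: "fps_nth L (Suc n) = ((lam - 1) gchoose n) / real (Suc n)" for n
    by (simp add: L_def gbinomial_negated_upper[of "lam - 1" n])
  have deriv_L: "(1 + fps_X) * fps_deriv L = 1 + fps_const lam * L"
  proof (rule fps_ext)
    fix n
    show "fps_nth ((1 + fps_X) * fps_deriv L) n = fps_nth (1 + fps_const lam * L) n"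
    proof (cases n)
      case 0
      then show ?thesis
        by (simp add: L_Suc[of 0, simplified] distrib_right) (simp add: L_def)
    next
      case (Suc k)
      have "real (Suc k) * ((lam - 1) gchoose Suc k) = (lam - 1 - real k) * ((lam - 1) gchoose k)"
        using gbinomial_mult_1[of "lam - 1" k] by (simp add: left_diff_distrib)
      then show ?thesis
        using Suc by (simp add: L_Suc distrib_right del: of_nat_Suc) (simp add: field_simps)
    qed
  qed
  define E where "E = dexp lam - 1"
  have E0 [simp]: "fps_nth E 0 = 0" by (simp add: E_def)
  have deriv_E: "(1 + fps_const lam * fps_X) * fps_deriv E = 1 + E"
  proof (rule fps_ext)
    fix n
    show "fps_nth ((1 + fps_const lam * fps_X) * fps_deriv E) n = fps_nth (1 + E) n"
    proof (cases n)
      case 0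
      then show ?thesis by (simp add: E_def distrib_right mult.assoc)
    next
      case (Suc k)
      have "fps_nth ((1 + fps_const lam * fps_X) * fps_deriv E) n =
          real (Suc n) * fps_nth (dexp lam) (Suc n) + lam * (real n * fps_nth (dexp lam) n)"
        using Suc by (simp add: E_def distrib_right mult.assoc del: dexp_nth)
      also have "\<dots> = fps_nth (dexp lam) n"
        unfolding dexp_Suc by (simp add: left_diff_distrib del: dexp_nth)
      finally show ?thesis
        using Suc by (simp add: E_def)
    qed
  qed
  define Y where "Y = L oo E"
  have "(1 + fps_const lam * fps_X) * fps_deriv Y
      = (fps_deriv L oo E) * ((1 + fps_const lam * fps_X) * fps_deriv E)"
    by (simp only: Y_def fps_compose_deriv[OF E0] mult_ac)
  also have "\<dots> = ((1 + fps_X) * fps_deriv L) oo E"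
    unfolding deriv_E by (simp add: fps_compose_mult_distrib fps_compose_add_distrib mult_ac)
  also have "\<dots> = 1 + fps_const lam * Y"
    by (simp add: deriv_L Y_def fps_compose_mult_distrib fps_compose_add_distrib)
  finally have deriv_Y: "(1 + fps_const lam * fps_X) * fps_deriv Y = 1 + fps_const lam * Y" .
  have Y0: "fps_nth Y 0 = 0"
    by (simp add: Y_def L_def)
  have Y1: "fps_nth Y (Suc 0) = 1"
    using arg_cong[OF deriv_Y, of "\<lambda>f. fps_nth f 0"] Y0 by (simp add: distrib_right)
  have step: "real (Suc (Suc n)) * fps_nth Y (Suc (Suc n))
      = lam * (1 - real (Suc n)) * fps_nth Y (Suc n)" for n
    using arg_cong[OF deriv_Y, of "\<lambda>f. fps_nth f (Suc n)"]
    by (simp add: distrib_right mult.assoc algebra_simps)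
  have Y2: "fps_nth Y (Suc (Suc n)) = 0" for n
  proof (induction n)
    case 0
    show ?case using step[of 0] by simp
  next
    case (Suc n)
    then show ?case using step[of "Suc n"] by simp
  qed
  have "Y = fps_X"
  proof (rule fps_ext)
    fix n
    show "fps_nth Y n = fps_nth fps_X n"
      using Y0 Y1 Y2 by (cases n; cases "n - 1") auto
  qed
  then have "L = dlog1p lam"
    by (intro dlog1p_unique) (simp add: Y_def E_def)
  then show ?thesis
    by (simp add: L_def)
qed

end

(* The generating function F n of row n satisfies F (n+1) = - ((1 - t) F n)' - n lam F n.
   Substituting 1 - e, where e = dexp lam satisfies (1 + lam t) e' = e, turns this into
   H (n+1) = (1 + lam t) (H n)' - n lam H n for H n = e * (F n oo (1 - e)), whose solution
   is H n = (1 + lam t)^n times the n-th derivative of H 0.  At t = 0 this says that b_{n,0}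
   is n! times the n-th coefficient of H 0, which is the first identity.  The second one
   follows by substituting the inverse of 1 - e. *)

theory Submission
  imports Defs
begin

text \<open>The recurrence \<open>dexp_Suc\<close>, read as a differential equation.\<close>

lemma dexp_deriv: "(1 + fps_const lam * fps_X) * fps_deriv (dexp lam) = dexp lam"
proof (rule fps_ext)
  fix n
  show "fps_nth ((1 + fps_const lam * fps_X) * fps_deriv (dexp lam)) n = fps_nth (dexp lam) n"
  proof (cases n)
    case 0
    then show ?thesis by (simp add: distrib_right mult.assoc)
  next
    case (Suc k)
    then have "fps_nth ((1 + fps_const lam * fps_X) * fps_deriv (dexp lam)) n =
        real (Suc n) * fps_nth (dexp lam) (Suc n) + lam * (real n * fps_nth (dexp lam) n)"
      by (simp add: distrib_right mult.assoc del: dexp_nth)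
    also have "\<dots> = fps_nth (dexp lam) n"
      unfolding dexp_Suc by (simp add: left_diff_distrib del: dexp_nth)
    finally show ?thesis .
  qed
qed

definition dA_row :: "real \<Rightarrow> (nat \<Rightarrow> real) \<Rightarrow> nat \<Rightarrow> real fps" where
  "dA_row lam b n = Abs_fps (dA lam b n)"

text \<open>The part \<open>(m + 1) * (b m - b (m + 1))\<close> of the recurrence is the coefficient
  of minus the derivative of \<open>(1 - fps_X) * F\<close>.\<close>

lemma dA_row_Suc:
  "dA_row lam b (Suc n) =
     - fps_deriv ((1 - fps_X) * dA_row lam b n) - fps_const (real n * lam) * dA_row lam b n"
proof (rule fps_ext)
  fix m
  have "dA lam b (Suc n) m =
      (real (Suc m) - real n * lam) * dA lam b n m - real (Suc m) * dA lam b n (Suc m)"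
    by (simp add: field_simps)
  then show "fps_nth (dA_row lam b (Suc n)) m = fps_nth (- fps_deriv ((1 - fps_X) * dA_row lam b n)
      - fps_const (real n * lam) * dA_row lam b n) m"
    by (simp add: dA_row_def left_diff_distrib del: dA.simps) (simp add: algebra_simps)
qed

definition dA_subst :: "real \<Rightarrow> (nat \<Rightarrow> real) \<Rightarrow> nat \<Rightarrow> real fps" where
  "dA_subst lam b n = dexp lam * (dA_row lam b n oo (1 - dexp lam))"

text \<open>The factor \<open>dexp lam\<close> is the image of \<open>1 - fps_X\<close> under the
  substitution, so the chain rule applies to the very product that the row recurrence
  differentiates.\<close>

lemma dA_subst_compose: "dA_subst lam b n = ((1 - fps_X) * dA_row lam b n) oo (1 - dexp lam)"
  by (simp add: dA_subst_def fps_compose_mult_distrib fps_compose_sub_distrib)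

text \<open>The inner derivative is \<open>- fps_deriv (dexp lam)\<close>: its sign cancels that of
  the row recurrence, and \<open>1 + fps_const lam * fps_X\<close> turns it into
  \<open>dexp lam\<close>.\<close>

lemma dA_subst_Suc:
  "dA_subst lam b (Suc n) = (1 + fps_const lam * fps_X) * fps_deriv (dA_subst lam b n)
     - fps_const (real n * lam) * dA_subst lam b n"
proof -
  define P where "P = (1 - fps_X) * dA_row lam b n"
  have "(1 + fps_const lam * fps_X) * fps_deriv (dA_subst lam b n) =
      - ((fps_deriv P oo (1 - dexp lam)) * ((1 + fps_const lam * fps_X) * fps_deriv (dexp lam)))"
    unfolding dA_subst_compose P_def[symmetric]
    by (subst fps_compose_deriv) (simp_all add: mult_ac)
  then have "(1 + fps_const lam * fps_X) * fps_deriv (dA_subst lam b n) =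
      - (dexp lam * (fps_deriv P oo (1 - dexp lam)))"
    unfolding dexp_deriv by (simp add: mult.commute)
  moreover have "dA_subst lam b (Suc n) = - (dexp lam * (fps_deriv P oo (1 - dexp lam)))
      - fps_const (real n * lam) * dA_subst lam b n"
    by (simp add: dA_subst_def dA_row_Suc P_def[symmetric] fps_compose_sub_distrib
        fps_compose_uminus fps_compose_mult_distrib right_diff_distrib mult_ac
        del: fps_deriv_mult fps_const_mult)
  ultimately show ?thesis by simp
qed

text \<open>The power acts as an integrating factor: the term from its derivative cancels the
  subtracted multiple of \<open>dA_subst lam b n\<close>.\<close>

lemma dA_subst_eq_nth_deriv:
  "dA_subst lam b n = (1 + fps_const lam * fps_X) ^ n * fps_nth_deriv n (dA_subst lam b 0)"
proof (induction n)
  case 0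
  show ?case by simp
next
  case (Suc n)
  define A where "A = 1 + fps_const lam * fps_X"
  define D where "D = fps_nth_deriv n (dA_subst lam b 0)"
  have "fps_deriv (A ^ n) = fps_const (real n * lam) * A ^ (n - 1)"
    unfolding fps_deriv_power by (simp add: A_def)
  \<comment> \<open>The exponent \<open>n - 1\<close> is truncated at \<open>n = 0\<close>, where
    the factor \<open>real n\<close> makes both sides vanish.\<close>
  then have "A * fps_deriv (A ^ n) = fps_const (real n * lam) * A ^ n"
    by (cases n) (simp_all only: diff_Suc_1 power_Suc mult_ac, simp_all)
  then have "A * fps_deriv (A ^ n * D) - fps_const (real n * lam) * (A ^ n * D) =
      A ^ Suc n * fps_deriv D"
    by (simp add: distrib_left algebra_simps)
  moreover have "fps_deriv D = fps_nth_deriv (Suc n) (dA_subst lam b 0)"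
    by (simp only: D_def fps_nth_deriv_commute)
  ultimately show ?case
    using Suc by (simp add: dA_subst_Suc flip: A_def D_def)
qed

lemma dA_egf_eq_dA_subst: "dA_egf lam b = dA_subst lam b 0"
proof (rule fps_ext)
  fix n
  \<comment> \<open>At 0 the factor \<open>dexp lam\<close> is 1 and the inner series
    \<open>1 - dexp lam\<close> is 0.\<close>
  have "dA lam b n 0 = fps_nth (dA_subst lam b n) 0"
    by (simp add: dA_subst_def dA_row_def)
  also have "\<dots> = fact n * fps_nth (dA_subst lam b 0) n"
    by (subst dA_subst_eq_nth_deriv) (simp add: fps_deriv_maclauren_0 fps_power_zeroth)
  finally show "fps_nth (dA_egf lam b) n = fps_nth (dA_subst lam b 0) n"
    by (simp add: dA_egf_def)
qed

text \<open>Negating \<open>dexp lam - 1\<close> is undone by negating the argument of its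
  inverse.\<close>

lemma one_minus_dexp_compose_dlog1p: "(1 - dexp lam) oo (dlog1p lam oo - fps_X) = fps_X"
proof -
  have "(1 - dexp lam) oo dlog1p lam = - ((dexp lam - 1) oo dlog1p lam)"
    by (simp flip: fps_compose_uminus)
  then show ?thesis
    by (simp add: dlog1p_right fps_compose_assoc fps_compose_uminus)
qed

theorem theorem3p2:
  fixes lam :: real and b :: "nat \<Rightarrow> real"
  assumes "lam \<noteq> 0"
  shows "dA_egf lam b = dexp lam * (dA_gf lam b oo (1 - dexp lam)) \<and>
         (1 - fps_X) * dA_gf lam b = dA_egf lam b oo (dlog1p lam oo (- fps_X))"
proof
  have row_0: "dA_row lam b 0 = dA_gf lam b"
    by (simp add: dA_row_def dA_gf_def)
  then show "dA_egf lam b = dexp lam * (dA_gf lam b oo (1 - dexp lam))"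
    by (simp add: dA_egf_eq_dA_subst dA_subst_def)
  \<comment> \<open>With \<open>1 - fps_X\<close> inside the composition, inverting the substitution
    yields the second identity directly.\<close>
  have "dA_egf lam b = ((1 - fps_X) * dA_gf lam b) oo (1 - dexp lam)"
    by (simp add: dA_egf_eq_dA_subst dA_subst_compose row_0)
  then have "dA_egf lam b oo (dlog1p lam oo - fps_X) =
      ((1 - fps_X) * dA_gf lam b) oo ((1 - dexp lam) oo (dlog1p lam oo - fps_X))"
    by (simp only:) (rule fps_compose_assoc[symmetric]; simp)
  then show "(1 - fps_X) * dA_gf lam b = dA_egf lam b oo (dlog1p lam oo - fps_X)"
    by (simp add: one_minus_dexp_compose_dlog1p)
qed

end
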